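(* Let $h:\mathbb{R}^n\to\mathbb{R}$ be a strongly quasiconvex function with modulus $\gamma>0$ which is differentiable with locally Lipschitz continuous gradient, and let $\overline{x}$ be its minimizer, $\{\overline{x}\}=\operatorname{argmin}_{\mathbb{R}^n}h$. Let $x^0\in\mathbb{R}^n$, let $L_0>0$ be a Lipschitz constant of $\nabla h$ on the sublevel set $\{x\in\mathbb{R}^n: h(x)\le h(x^0)\}$, and let $\{\beta_k\}_k$ be a positive sequence satisfying $$0<\underline{\beta}\le\beta_k\le\overline{\beta}<\min\left\{\frac{\gamma}{L_0^2},\frac{2}{L_0}\right\}$$ for all $k\ge0$, for some constants $\underline{\beta},\overline{\beta}$. Then the sequence $\{x^k\}_k$ generated by the gradient method $x^{k+1}=x^k-\beta_k\nabla h(x^k)$, $k\ge0$, converges linearly to the unique minimizer $\overline{x}$.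
   Context: $\|\cdot\|$ is the Euclidean norm on $\mathbb{R}^n$. A function $h:\mathbb{R}^n\to\mathbb{R}$ is strongly quasiconvex with modulus $\gamma>0$ if for all $x,y\in\mathbb{R}^n$ and all $\lambda\in[0,1]$, $$h(\lambda y+(1-\lambda)x)\le\max\{h(y),h(x)\}-\lambda(1-\lambda)\frac{\gamma}{2}\|x-y\|^2.$$ It is known that a lower semicontinuous strongly quasiconvex function on $\mathbb{R}^n$ has exactly one minimizer and that its sublevel sets $\{x: h(x)\le h(x^0)\}$ are compact; since $\nabla h$ is locally Lipschitz, it is Lipschitz on this compact set, so a constant $L_0$ as in the claim exists. The sequence converges linearly to $\overline{x}$ if there is $q\in\,]0,1[$ with $\|x^{k+1}-\overline{x}\|\le q\|x^k-\overline{x}\|$ for all $k$. (If the algorithm stops because $x^{k+1}=x^k$, the sequence is regarded as constant from then on.) *)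

theory Defs
  imports "HOL-Analysis.Analysis"
begin

definition strongly_quasiconvex :: "real \<Rightarrow> ('a::real_normed_vector \<Rightarrow> real) \<Rightarrow> bool"
  where "strongly_quasiconvex \<gamma> h \<longleftrightarrow>
    (\<forall>x y. \<forall>l\<in>{0..1}.
      h (l *\<^sub>R y + (1 - l) *\<^sub>R x) \<le> max (h y) (h x) - l * (1 - l) * (\<gamma> / 2) * (norm (x - y))\<^sup>2)"

definition locally_lipschitz :: "('a::metric_space \<Rightarrow> 'b::metric_space) \<Rightarrow> bool"
  where "locally_lipschitz f \<longleftrightarrow> (\<forall>x. \<exists>u>0. \<exists>L. L-lipschitz_on (cball x u) f)"

(* The library's local_lipschitz carries an extra parameter set; here it is inert. *)
lemma locally_lipschitz_iff_local_lipschitz: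
  "locally_lipschitz f \<longleftrightarrow> local_lipschitz (UNIV :: real set) UNIV (\<lambda>_. f)"
proof -
  have "\<exists>s. dist t s \<le> u" if "u > 0" for t u :: real
    using that by (intro exI[of _ t]) simp
  then show ?thesis
    unfolding locally_lipschitz_def local_lipschitz_def by (simp cong: conj_cong)
qed

(* A one-step contraction at every index, not only asymptotically;
   the limit may be attained after finitely many steps. *)
definition converges_linearly_to :: "(nat \<Rightarrow> 'a::real_normed_vector) \<Rightarrow> 'a \<Rightarrow> bool"
  where "converges_linearly_to x xbar \<longleftrightarrow>
    (\<exists>q. 0 < q \<and> q < 1 \<and> (\<forall>k. norm (x (Suc k) - xbar) \<le> q * norm (x k - xbar)))"

end

theory Submission
  imports Defs
begin

text \<open>
  Differentiating the strong quasiconvexity inequality along the segment from \<open>z\<close> to the minimizer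
  gives \<open>\<gamma>/2 * |z - xbar|\<^sup>2 \<le> (z - xbar) \<bullet> grad z\<close>. Together with \<open>|grad z| \<le> L0 * |z - xbar|\<close>, valid on
  the sublevel set because the gradient vanishes at \<open>xbar\<close>, expanding the square yields
  \<open>|z - \<beta> grad z - xbar|\<^sup>2 \<le> (1 - \<beta> * (\<gamma> - \<beta> * L0\<^sup>2)) * |z - xbar|\<^sup>2\<close>. The iterates stay in the
  sublevel set since \<open>\<beta> < 2 / L0\<close>: otherwise \<open>h\<close> would return to the value \<open>h z\<close> at some point of the
  step, the whole segment up to that point would lie in the (convex) sublevel set, and the descent
  inequality on this segment would force a strict decrease.
\<close>

lemma GDERIV_line:
  assumes "GDERIV h (z + t *\<^sub>R d) :> D"
  shows "((\<lambda>s. h (z + s *\<^sub>R d)) has_real_derivative d \<bullet> D) (at t)"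
proof -
  have "((\<lambda>s. z + s *\<^sub>R d) has_derivative (\<lambda>s. s *\<^sub>R d)) (at t)"
    by (auto intro!: derivative_eq_intros)
  from has_derivative_compose[OF this assms[unfolded gderiv_def]]
  show ?thesis
    by (rule has_derivative_imp_has_field_derivative) simp
qed

text \<open>Fermat's rule on the line through \<open>z\<close> in direction \<open>D\<close> itself,
  where the derivative at 0 is \<open>D \<bullet> D\<close>.\<close>

lemma GDERIV_arg_min_eq_0:
  assumes "GDERIV h z :> D" and "is_arg_min h (\<lambda>_. True) z"
  shows "D = 0"
proof -
  have "((\<lambda>s. h (z + s *\<^sub>R D)) has_real_derivative D \<bullet> D) (at 0)"
    using assms(1) by (intro GDERIV_line) simp
  moreover have "h z \<le> h (z + s *\<^sub>R D)" for s
    using assms(2) unfolding is_arg_min_linorder by simp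
  ultimately have "D \<bullet> D = 0"
    using DERIV_local_min[of "\<lambda>s. h (z + s *\<^sub>R D)" "D \<bullet> D" 0 1] by simp
  then show ?thesis by simp
qed

lemma strongly_quasiconvex_le_max:
  assumes "strongly_quasiconvex \<gamma> h" "\<gamma> \<ge> 0" "l \<in> {0..1}"
  shows "h (l *\<^sub>R y + (1 - l) *\<^sub>R z) \<le> max (h y) (h z)"
proof -
  have "h (l *\<^sub>R y + (1 - l) *\<^sub>R z) \<le> max (h y) (h z) - l * (1 - l) * (\<gamma> / 2) * (norm (z - y))\<^sup>2"
    using assms(1,3) unfolding strongly_quasiconvex_def by blast
  moreover have "0 \<le> l * (1 - l) * (\<gamma> / 2) * (norm (z - y))\<^sup>2"
    using assms(2,3) by simp
  ultimately show ?thesis by linarith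
qed

lemma strongly_quasiconvex_inner_gradient:
  assumes "strongly_quasiconvex \<gamma> h" and "GDERIV h z :> D" and "h y \<le> h z"
  shows "\<gamma> / 2 * (norm (z - y))\<^sup>2 \<le> (z - y) \<bullet> D"
proof (rule ccontr)
  define c where "c = \<gamma> / 2 * (norm (z - y))\<^sup>2"
  \<comment> \<open>The quadratic deficit is moved to the side of \<open>h\<close>: as
    \<open>h y \<le> h z\<close>, strong quasiconvexity says \<open>\<psi> l \<le> \<psi> 0\<close>
    on [0, 1], while failure of the claim makes the derivative of \<open>\<psi>\<close> at 0
    positive.\<close>
  define \<psi> where "\<psi> = (\<lambda>l. h (z + l *\<^sub>R (y - z)) + l * (1 - l) * c)"
  assume "\<not> ?thesis"
  then have pos: "0 < (y - z) \<bullet> D + c"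
    by (simp add: c_def inner_diff_left)
  have "((\<lambda>l. h (z + l *\<^sub>R (y - z))) has_real_derivative (y - z) \<bullet> D) (at 0)"
    using assms(2) by (intro GDERIV_line) simp
  then have "(\<psi> has_real_derivative (y - z) \<bullet> D + c) (at 0)"
    unfolding \<psi>_def by (auto intro!: derivative_eq_intros)
  from DERIV_pos_inc_right[OF this pos] obtain e
    where e: "e > 0" "\<And>l. 0 < l \<Longrightarrow> l < e \<Longrightarrow> \<psi> 0 < \<psi> l" by auto
  define l where "l = min (e / 2) 1"
  have l: "0 < l" "l < e" "l \<le> 1" using e(1) by (auto simp: l_def)
  have "h (l *\<^sub>R y + (1 - l) *\<^sub>R z) \<le> max (h y) (h z) - l * (1 - l) * (\<gamma> / 2) * (norm (z - y))\<^sup>2"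
    using assms(1) l unfolding strongly_quasiconvex_def by simp
  moreover have "l *\<^sub>R y + (1 - l) *\<^sub>R z = z + l *\<^sub>R (y - z)"
    by (simp add: algebra_simps)
  ultimately have "\<psi> l \<le> \<psi> 0"
    using assms(3) by (simp add: \<psi>_def c_def)
  with e(2)[OF l(1,2)] show False by simp
qed

text \<open>\<open>S\<close> need not be convex: the Lipschitz bound is used only between
  \<open>z\<close> and points of the segment. So the lemma applies to a part of a gradient step
  whose endpoint may lie outside \<open>S\<close>.\<close>

lemma descent_inequality:
  assumes grad: "\<And>z. GDERIV h z :> grad z" and lip: "L-lipschitz_on S grad"
    and seg: "\<And>t. 0 \<le> t \<Longrightarrow> t \<le> T \<Longrightarrow> z - t *\<^sub>R grad z \<in> S" and "0 \<le> T"
  shows "h (z - T *\<^sub>R grad z) \<le> h z - T * (1 - L * T / 2) * (norm (grad z))\<^sup>2"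
proof -
  define d where "d = - grad z"
  \<comment> \<open>The added term is the antiderivative of
    \<open>(1 - L * t) * (norm d)\<^sup>2\<close>, so the derivative of \<open>\<phi>\<close> is
    \<open>d \<bullet> (grad (z + t *\<^sub>R d) - grad z) - L * t * (norm d)\<^sup>2\<close>, which
    Cauchy-Schwarz and the Lipschitz bound make nonpositive.\<close>
  define \<phi> where "\<phi> = (\<lambda>t. h (z + t *\<^sub>R d) + t * (1 - L * t / 2) * (norm d)\<^sup>2)"
  have "\<phi> T \<le> \<phi> 0"
  proof (rule DERIV_nonpos_imp_nonincreasing[OF \<open>0 \<le> T\<close>])
    fix t assume t: "0 \<le> t" "t \<le> T"
    have "(\<phi> has_real_derivative d \<bullet> grad (z + t *\<^sub>R d) + (1 - L * t) * (norm d)\<^sup>2) (at t)"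
      unfolding \<phi>_def
      by (auto intro!: derivative_eq_intros GDERIV_line grad simp: field_simps)
    moreover have "d \<bullet> grad (z + t *\<^sub>R d) + (1 - L * t) * (norm d)\<^sup>2 \<le> 0"
    proof -
      have "norm (grad (z + t *\<^sub>R d) - grad z) \<le> L * norm (t *\<^sub>R d)"
        using lipschitz_onD[OF lip seg[OF t] seg[of 0]] t by (simp add: dist_norm d_def)
      then have "norm d * norm (grad (z + t *\<^sub>R d) - grad z) \<le> norm d * (L * norm (t *\<^sub>R d))"
        by (rule mult_left_mono) simp
      then have "d \<bullet> (grad (z + t *\<^sub>R d) - grad z) \<le> L * t * (norm d)\<^sup>2"
        using norm_cauchy_schwarz[of d "grad (z + t *\<^sub>R d) - grad z"] t(1)
        by (simp add: power2_eq_square mult_ac)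
      moreover have "d \<bullet> grad z = - (norm d)\<^sup>2"
        by (simp add: d_def power2_norm_eq_inner)
      ultimately show ?thesis
        by (simp add: inner_diff_right algebra_simps)
    qed
    ultimately show "\<exists>y. (\<phi> has_real_derivative y) (at t) \<and> y \<le> 0" by blast
  qed
  then show ?thesis
    by (simp add: \<phi>_def d_def)
qed

lemma gradient_step_le:
  assumes qc: "strongly_quasiconvex \<gamma> h" and "\<gamma> \<ge> 0"
    and grad: "\<And>z. GDERIV h z :> grad z" and lip: "L-lipschitz_on {w. h w \<le> h z} grad"
    and "L > 0" "0 < b" "b < 2 / L"
  shows "h (z - b *\<^sub>R grad z) \<le> h z"
proof (rule ccontr)
  define g where "g = (\<lambda>t. h (z + t *\<^sub>R - grad z))"
  assume "\<not> ?thesis"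
  then have gb: "g 0 < g b" by (simp add: g_def)
  then have nz: "grad z \<noteq> 0" by (auto simp: g_def)
  have der: "(g has_real_derivative - grad z \<bullet> grad (z + t *\<^sub>R - grad z)) (at t)" for t
    unfolding g_def by (rule GDERIV_line[OF grad])
  have "- grad z \<bullet> grad (z + 0 *\<^sub>R - grad z) < 0" using nz by simp
  from DERIV_neg_dec_right[OF der this] obtain e
    where e: "e > 0" "\<And>t. 0 < t \<Longrightarrow> t < e \<Longrightarrow> g t < g 0" by auto
  \<comment> \<open>At \<open>s\<close> the value is already below \<open>g 0\<close>. Starting the
    intermediate value theorem there rather than at 0 ensures that the return point \<open>T\<close>
    is positive.\<close>
  define s where "s = min (e / 2) b"
  have s: "0 < s" "s < e" "s \<le> b" using e(1) \<open>0 < b\<close> by (auto simp: s_def)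
  have "\<exists>t\<ge>s. t \<le> b \<and> g t = g 0"
    using e(2)[OF s(1,2)] gb s(3) der by (intro IVT) (auto intro: DERIV_isCont)
  then obtain T where T: "s \<le> T" "T \<le> b" "g T = g 0" by blast
  have "0 < T" using s(1) T(1) by simp
  \<comment> \<open>Both ends of the segment have value \<open>h z\<close>, and \<open>t / T\<close>
    is the weight of the far end.\<close>
  have "z - t *\<^sub>R grad z \<in> {w. h w \<le> h z}" if "0 \<le> t" "t \<le> T" for t
  proof -
    have "h ((t / T) *\<^sub>R (z - T *\<^sub>R grad z) + (1 - t / T) *\<^sub>R z) \<le> max (h (z - T *\<^sub>R grad z)) (h z)"
      using that \<open>0 < T\<close> by (intro strongly_quasiconvex_le_max[OF qc \<open>\<gamma> \<ge> 0\<close>]) auto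
    moreover have "(t / T) *\<^sub>R (z - T *\<^sub>R grad z) + (1 - t / T) *\<^sub>R z = z - t *\<^sub>R grad z"
      using \<open>0 < T\<close> by (simp add: algebra_simps)
    ultimately show ?thesis using T(3) by (simp add: g_def)
  qed
  from descent_inequality[where T = T, OF grad lip this]
  have "T * (1 - L * T / 2) * (norm (grad z))\<^sup>2 \<le> 0"
    using \<open>0 < T\<close> T(3) by (simp add: g_def)
  moreover have "L * T < 2"
  proof -
    have "T < 2 / L" using T(2) \<open>b < 2 / L\<close> by simp
    then show ?thesis using \<open>L > 0\<close> by (simp add: field_simps)
  qed
  then have "0 < T * (1 - L * T / 2) * (norm (grad z))\<^sup>2"
    using \<open>0 < T\<close> nz by simp
  ultimately show False by simp
qed

lemma gradient_step_contraction:
  fixes z y D :: "'a::real_inner"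
  assumes "c * (norm (z - y))\<^sup>2 \<le> (z - y) \<bullet> D" and "norm D \<le> L * norm (z - y)" and "0 \<le> b"
  shows "(norm (z - b *\<^sub>R D - y))\<^sup>2 \<le> (1 - b * (2 * c - b * L\<^sup>2)) * (norm (z - y))\<^sup>2"
proof -
  have "(norm (z - b *\<^sub>R D - y))\<^sup>2 = (norm (z - y))\<^sup>2 - 2 * b * ((z - y) \<bullet> D) + b\<^sup>2 * (norm D)\<^sup>2"
    unfolding power2_norm_eq_inner
    by (simp add: inner_diff_left inner_diff_right inner_commute power2_eq_square algebra_simps)
  also have "\<dots> \<le> (norm (z - y))\<^sup>2 - 2 * b * (c * (norm (z - y))\<^sup>2) + b\<^sup>2 * (L * norm (z - y))\<^sup>2"
    using assms by (intro add_mono diff_mono mult_left_mono power_mono) auto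
  also have "\<dots> = (1 - b * (2 * c - b * L\<^sup>2)) * (norm (z - y))\<^sup>2"
    by (simp add: power2_eq_square algebra_simps)
  finally show ?thesis .
qed

theorem theorem20:
  fixes h :: "real ^ 'n \<Rightarrow> real"
    and grad :: "real ^ 'n \<Rightarrow> real ^ 'n"
    and x :: "nat \<Rightarrow> real ^ 'n"
    and x0 xbar :: "real ^ 'n"
    and \<beta> :: "nat \<Rightarrow> real"
    and \<gamma> L0 \<beta>lo \<beta>hi :: real
  assumes "\<gamma> > 0"
    and "strongly_quasiconvex \<gamma> h"
    and "\<And>z. GDERIV h z :> grad z"
    and "locally_lipschitz grad"
    and "{z. is_arg_min h (\<lambda>_. True) z} = {xbar}"
    and "L0 > 0"
    and "L0-lipschitz_on {z. h z \<le> h x0} grad"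
    and "0 < \<beta>lo"
    and "\<And>k. \<beta>lo \<le> \<beta> k \<and> \<beta> k \<le> \<beta>hi"
    and "\<beta>hi < min (\<gamma> / L0\<^sup>2) (2 / L0)"
    and "x 0 = x0"
    and "\<And>k. x (Suc k) = x k - \<beta> k *\<^sub>R grad (x k)"
  shows "converges_linearly_to x xbar"
proof -
  define r where "r = 1 - \<beta>lo * (\<gamma> - \<beta>hi * L0\<^sup>2)"
  \<comment> \<open>The maximum with 1/2 keeps \<open>q\<close> positive whatever the sign of
    \<open>r\<close>; the square root undoes the squared norms of the contraction estimate.\<close>
  define q where "q = sqrt (max r (1 / 2))"
  have \<beta>: "0 < \<beta> k" "\<beta> k < 2 / L0" for k
    using assms(8,10) assms(9)[of k] by auto
  have "\<beta>hi < \<gamma> / L0\<^sup>2" using assms(10) by simp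
  then have gap: "0 < \<gamma> - \<beta>hi * L0\<^sup>2"
    using \<open>L0 > 0\<close> by (simp add: field_simps)
  have xbar: "is_arg_min h (\<lambda>_. True) xbar" using assms(5) by blast
  then have min: "h xbar \<le> h z" for z unfolding is_arg_min_linorder by simp
  have grad_xbar: "grad xbar = 0" using GDERIV_arg_min_eq_0[OF assms(3) xbar] .
  have sub: "h (x k) \<le> h x0" for k
  proof (induction k)
    case (Suc k)
    \<comment> \<open>By induction the sublevel set of \<open>x k\<close> lies in that of
      \<open>x0\<close>, so the same constant serves at every step.\<close>
    have "L0-lipschitz_on {w. h w \<le> h (x k)} grad"
      using Suc by (intro lipschitz_on_subset[OF assms(7)]) auto
    then have "h (x (Suc k)) \<le> h (x k)"
      unfolding assms(12)
      using \<open>\<gamma> > 0\<close> \<open>L0 > 0\<close> \<beta> by (intro gradient_step_le[OF assms(2) _ assms(3), of L0]) auto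
    with Suc show ?case by simp
  qed (simp add: assms(11))
  have "norm (x (Suc k) - xbar) \<le> q * norm (x k - xbar)" for k
  proof (rule power2_le_imp_le)
    have "norm (grad (x k)) \<le> L0 * norm (x k - xbar)"
      using lipschitz_onD[OF assms(7), of "x k" xbar] sub min by (simp add: grad_xbar dist_norm)
    then have "(norm (x (Suc k) - xbar))\<^sup>2
        \<le> (1 - \<beta> k * (2 * (\<gamma> / 2) - \<beta> k * L0\<^sup>2)) * (norm (x k - xbar))\<^sup>2"
      unfolding assms(12) using \<beta>(1)[of k]
      by (intro gradient_step_contraction strongly_quasiconvex_inner_gradient[OF assms(2,3)] min) auto
    also have "\<dots> \<le> r * (norm (x k - xbar))\<^sup>2"
    proof -
      \<comment> \<open>The two factors are bounded separately, one by the lower and one by the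
        upper step bound; \<open>gap\<close> provides the sign needed to multiply the
        bounds.\<close>
      have "\<beta>lo * (\<gamma> - \<beta>hi * L0\<^sup>2) \<le> \<beta> k * (\<gamma> - \<beta> k * L0\<^sup>2)"
        using gap assms(8) assms(9)[of k] by (intro mult_mono diff_mono mult_right_mono) auto
      then show ?thesis by (intro mult_right_mono) (auto simp: r_def)
    qed
    also have "\<dots> \<le> (q * norm (x k - xbar))\<^sup>2"
      by (auto simp: q_def power_mult_distrib intro!: mult_right_mono)
    finally show "(norm (x (Suc k) - xbar))\<^sup>2 \<le> (q * norm (x k - xbar))\<^sup>2" .
  qed (simp add: q_def)
  moreover have "r < 1" using gap assms(8) by (simp add: r_def)
  then have "0 < q" "q < 1" by (auto simp: q_def)
  ultimately show ?thesis unfolding converges_linearly_to_def by blast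
qed

end
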